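(* Let $\Gamma$ be a bridgeless metrized graph of genus $g$. Then $$g\cdot x(\Gamma)=y(\Gamma)+\sum_{e_i\in E(\Gamma)}\frac{L_i}{L_i+R_i}x(\Gamma-e_i),\qquad (g+1)\,y(\Gamma)=\sum_{e_i\in E(\Gamma)}\frac{L_i}{L_i+R_i}y(\Gamma-e_i).$$
   Context: A metrized graph is a finite connected graph (multiple edges and self-loops allowed) whose edges $e_j$ are identified with closed segments of lengths $L_j>0$; its vertex set is finite, nonempty, and contains all points of valence $\neq2$; $g=e-v+1$. $G-e_j$ is $G$ with the interior of $e_j$ removed; $\Gamma$ is bridgeless if each $\Gamma-e_j$ is connected. View a metrized graph $G$ as an electric circuit with edge resistances equal to lengths; the voltage function $j_z(x,y)$ is the voltage at $x$ (reference $0$ at $z$) when unit current enters at $y$ and exits at $z$. For an edge $e_j$ of $G$ with endpoints $p_j,q_j$, $R_j$ is the effective resistance between $p_j,q_j$ in $G-e_j$, and for a fixed vertex $p$, with $\hat j$ the voltage function of $G-e_j$, $R_{a_j,p}=\hat j_{p_j}(p,q_j)$, $R_{b_j,p}=\hat j_{q_j}(p_j,p)$. Define $y(G)=\frac14\sum_{e_j}\frac{L_jR_j^2}{(L_j+R_j)^2}+\frac34\sum_{e_j}\frac{L_j(R_{a_j,p}-R_{b_j,p})^2}{(L_j+R_j)^2}$, $x(G)=\sum_{e_j}\frac{L_j^2R_j}{(L_j+R_j)^2}+\frac34\sum_{e_j}\frac{L_jR_j^2}{(L_j+R_j)^2}-\frac34\sum_{e_j}\frac{L_j(R_{a_j,p}-R_{b_j,p})^2}{(L_j+R_j)^2}$.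 If $e_j$ is a bridge of $G$ ($R_j=\infty$), then $(R_{a_j,p}-R_{b_j,p})^2=R_j^2$ and each summand is replaced by its limit as $R_j\to\infty$. $R_i$ in the claim refers to $\Gamma$. *)

theory Defs
  imports Complex_Main "Graph_Theory.Digraph_Component"
begin

text \<open>
  A metrized graph is given by its combinatorial model: a finite connected multigraph (loops and
  parallel edges allowed) together with positive edge lengths.  Each edge is an arc of a digraph;
  the direction of the arc only records which end point is called \<open>p\<^sub>e\<close> (the tail) and which one
  \<open>q\<^sub>e\<close> (the head), and none of the notions below depends on it.  Interior points of edges have
  valence 2, so the vertex set contains all points of valence different from 2 by construction;
  \<open>Digraph_Component.connected\<close> includes non-emptiness of the vertex set.
\<close>

locale metrized_graph = fin_digraph G for G :: "('a, 'b) pre_digraph" +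
  fixes L :: "'b \<Rightarrow> real"
  assumes connected: "Digraph_Component.connected G"
    and length_pos: "e \<in> arcs G \<Longrightarrow> L e > 0"

definition genus :: "('a, 'b) pre_digraph \<Rightarrow> int" where
  "genus G = int (card (arcs G)) - int (card (verts G)) + 1"

text \<open>\<open>pre_digraph.del_arc\<close> keeps all vertices, i.e. only the interior of the edge is removed.\<close>

definition bridge :: "('a, 'b) pre_digraph \<Rightarrow> 'b \<Rightarrow> bool" where
  "bridge G e \<longleftrightarrow> e \<in> arcs G \<and> \<not> Digraph_Component.connected (pre_digraph.del_arc G e)"

definition bridgeless :: "('a, 'b) pre_digraph \<Rightarrow> bool" where
  "bridgeless G \<longleftrightarrow> (\<forall>e \<in> arcs G. \<not> bridge G e)"

text \<open>
  The total current leaving the vertex \<open>x\<close> through the edges at \<open>x\<close> when the vertices have potentials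
  \<open>f\<close> (Ohm's law, edge resistances \<open>L\<close>); a loop contributes 0.
\<close>

definition outflow :: "('a, 'b) pre_digraph \<Rightarrow> ('b \<Rightarrow> real) \<Rightarrow> ('a \<Rightarrow> real) \<Rightarrow> 'a \<Rightarrow> real" where
  "outflow G L f x =
     (\<Sum>e \<in> out_arcs G x. (f x - f (head G e)) / L e)
   + (\<Sum>e \<in> in_arcs G x. (f x - f (tail G e)) / L e)"

text \<open>
  Kirchhoff's law: unit current enters at \<open>y\<close> and exits at \<open>z\<close>, and \<open>z\<close> has potential 0.
  On a connected graph the potential \<open>f\<close> exists and is unique on the vertices (its values elsewhere
  are irrelevant), and it is affine along each edge, so that the vertices suffice.
\<close>

definition is_potential ::
    "('a, 'b) pre_digraph \<Rightarrow> ('b \<Rightarrow> real) \<Rightarrow> 'a \<Rightarrow> 'a \<Rightarrow> ('a \<Rightarrow> real) \<Rightarrow> bool" where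
  "is_potential G L z y f \<longleftrightarrow>
     f z = 0 \<and> (\<forall>x \<in> verts G. outflow G L f x = of_bool (x = y) - of_bool (x = z))"

text \<open>\<open>voltage G L z x y\<close> is $j_z(x,y)$.\<close>

definition voltage :: "('a, 'b) pre_digraph \<Rightarrow> ('b \<Rightarrow> real) \<Rightarrow> 'a \<Rightarrow> 'a \<Rightarrow> 'a \<Rightarrow> real" where
  "voltage G L z x y = (THE t. \<exists>f. is_potential G L z y f \<and> t = f x)"

definition effective_resistance ::
    "('a, 'b) pre_digraph \<Rightarrow> ('b \<Rightarrow> real) \<Rightarrow> 'a \<Rightarrow> 'a \<Rightarrow> real" where
  "effective_resistance G L x y = voltage G L y x x"

text \<open>\<open>R G L e\<close>, \<open>Ra G L p e\<close>, \<open>Rb G L p e\<close> are $R_e$, $R_{a_e,p}$, $R_{b_e,p}$; they are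
  meaningful only if \<open>e\<close> is not a bridge.\<close>

definition R :: "('a, 'b) pre_digraph \<Rightarrow> ('b \<Rightarrow> real) \<Rightarrow> 'b \<Rightarrow> real" where
  "R G L e = effective_resistance (pre_digraph.del_arc G e) L (tail G e) (head G e)"

definition Ra :: "('a, 'b) pre_digraph \<Rightarrow> ('b \<Rightarrow> real) \<Rightarrow> 'a \<Rightarrow> 'b \<Rightarrow> real" where
  "Ra G L p e = voltage (pre_digraph.del_arc G e) L (tail G e) p (head G e)"

definition Rb :: "('a, 'b) pre_digraph \<Rightarrow> ('b \<Rightarrow> real) \<Rightarrow> 'a \<Rightarrow> 'b \<Rightarrow> real" where
  "Rb G L p e = voltage (pre_digraph.del_arc G e) L (head G e) (tail G e) p"

text \<open>
  The sum over all edges \<open>e\<close> of \<open>F l r d\<close> at $l = L_e$, $r = R_e$, $d = (R_{a_e,p} - R_{b_e,p})^2$.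
  For a bridge, where $R_e = \infty$ and $(R_{a_e,p} - R_{b_e,p})^2 = R_e^2$, the summand is the
  limit of \<open>F l r (r\<^sup>2)\<close> as \<open>r\<close> tends to infinity.
\<close>

definition edge_sum :: "('a, 'b) pre_digraph \<Rightarrow> ('b \<Rightarrow> real) \<Rightarrow> 'a \<Rightarrow>
    (real \<Rightarrow> real \<Rightarrow> real \<Rightarrow> real) \<Rightarrow> real" where
  "edge_sum G L p F =
     (\<Sum>e \<in> arcs G.
        if bridge G e then Lim at_top (\<lambda>r. F (L e) r (r\<^sup>2))
        else F (L e) (R G L e) ((Ra G L p e - Rb G L p e)\<^sup>2))"

definition y_inv :: "('a, 'b) pre_digraph \<Rightarrow> ('b \<Rightarrow> real) \<Rightarrow> 'a \<Rightarrow> real" where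
  "y_inv G L p =
     1/4 * edge_sum G L p (\<lambda>l r d. l * r\<^sup>2 / (l + r)\<^sup>2)
   + 3/4 * edge_sum G L p (\<lambda>l r d. l * d / (l + r)\<^sup>2)"

definition x_inv :: "('a, 'b) pre_digraph \<Rightarrow> ('b \<Rightarrow> real) \<Rightarrow> 'a \<Rightarrow> real" where
  "x_inv G L p =
     edge_sum G L p (\<lambda>l r d. l\<^sup>2 * r / (l + r)\<^sup>2)
   + 3/4 * edge_sum G L p (\<lambda>l r d. l * r\<^sup>2 / (l + r)\<^sup>2)
   - 3/4 * edge_sum G L p (\<lambda>l r d. l * d / (l + r)\<^sup>2)"

end

theory Submission
  imports Defs "Jordan_Normal_Form.Determinant" "HOL-Real_Asymp.Real_Asymp"
begin

text \<open>
  Let \<open>g\<close> be the Green function of the Laplacian, \<open>r\<close> the effective resistance, \<open>u\<^sub>i\<close> the potential of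
  a unit current running from the tail to the head of the edge \<open>i\<close>, \<open>K\<^sub>e\<^sub>i\<close> the voltage of \<open>u\<^sub>i\<close> across
  \<open>e\<close>, and \<open>D\<^sub>e = r(p, p\<^sub>e) - r(p, q\<^sub>e)\<close>, everything computed in \<open>\<Gamma>\<close> itself and not in \<open>\<Gamma> - e\<close>.
  Then \<open>R\<^sub>e = K\<^sub>e\<^sub>e L\<^sub>e / (L\<^sub>e - K\<^sub>e\<^sub>e)\<close> and \<open>R\<^sub>a - R\<^sub>b = L\<^sub>e D\<^sub>e / (L\<^sub>e - K\<^sub>e\<^sub>e)\<close>, so that, bridges included,
  \<open>4 y = \<Sum> (K\<^sub>e\<^sub>e\<^sup>2 + 3 D\<^sub>e\<^sup>2) / L\<^sub>e\<close> and \<open>x + y = \<Sum> K\<^sub>e\<^sub>e\<close>.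

  Deleting \<open>i\<close> is a rank-one perturbation of the Laplacian: with \<open>c = L\<^sub>i - K\<^sub>i\<^sub>i\<close> it replaces \<open>K\<^sub>e\<^sub>e\<close> by
  \<open>K\<^sub>e\<^sub>e + K\<^sub>e\<^sub>i\<^sup>2 / c\<close> and \<open>r(p, x)\<close> by \<open>r(p, x) + (u\<^sub>i(x) - u\<^sub>i(p))\<^sup>2 / c\<close>.  The weight \<open>L\<^sub>i / (L\<^sub>i + R\<^sub>i)\<close> is
  \<open>c / L\<^sub>i\<close>, and the weights add up to the genus by Foster's theorem.  Expanding the sums over \<open>i\<close>,
  the terms of order \<open>1 / c\<close> are summed by \<open>\<Sum>\<^sub>i K\<^sub>e\<^sub>i\<^sup>2 / L\<^sub>i = K\<^sub>e\<^sub>e\<close> and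
  \<open>\<Sum>\<^sub>i (u\<^sub>i(x) - u\<^sub>i(p))\<^sup>2 / L\<^sub>i = r(p, x)\<close>.  Those of order \<open>1 / c\<^sup>2\<close> occur in the combination
  \<open>\<Sum>\<^sub>e (3 (a\<^sup>2 - b\<^sup>2)\<^sup>2 + (a - b)\<^sup>4) / L\<^sub>e\<close>, where \<open>a\<close>, \<open>b\<close> are the values of \<open>f = u\<^sub>i - u\<^sub>i(p)\<close> at the end
  points of \<open>e\<close>; this is \<open>4\<close> times the energy pairing of \<open>f\<^sup>3\<close> and \<open>f\<close>, hence a function of the values
  of \<open>f\<close> at the end points of \<open>i\<close> alone.
\<close>

section \<open>The discrete Laplacian\<close>

text \<open>Enumerating \<open>V\<close> turns the system into a square matrix; a trivial kernel
  makes its determinant nonzero.\<close>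

lemma injective_imp_solvable:
  fixes a :: "'a \<Rightarrow> 'a \<Rightarrow> real" and c :: "'a \<Rightarrow> real"
  assumes fin: "finite V"
    and inj: "\<And>f. \<lbrakk>\<And>x. x \<in> V \<Longrightarrow> (\<Sum>y\<in>V. a x y * f y) = 0\<rbrakk> \<Longrightarrow> \<forall>y\<in>V. f y = 0"
  shows "\<exists>f. \<forall>x\<in>V. (\<Sum>y\<in>V. a x y * f y) = c x"
proof -
  define n where "n = card V"
  obtain h where h: "bij_betw h {0..<n} V"
    using ex_bij_betw_nat_finite[OF fin] unfolding n_def by blast
  define k where "k = inv_into {0..<n} h"
  have surj: "h ` {0..<n} = V" using h by (rule bij_betw_imp_surj_on)
  have hk: "h (k x) = x" "k x < n" if "x \<in> V" for x
    using that inv_into_into[of x h "{0..<n}"] f_inv_into_f[of x h "{0..<n}"]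
    by (simp_all add: surj k_def)
  have kh: "k (h i) = i" if "i < n" for i
    using that h unfolding k_def bij_betw_def by (auto simp: inv_into_f_f)
  have hV: "h i \<in> V" if "i < n" for i using that h unfolding bij_betw_def by auto
  define A where "A = mat n n (\<lambda>(i,j). a (h i) (h j))"
  have A: "A \<in> carrier_mat n n" by (simp add: A_def)
  have prod: "(A *\<^sub>v v) $ k x = (\<Sum>y\<in>V. a x y * v $ k y)"
    if "x \<in> V" "v \<in> carrier_vec n" for v x
  proof -
    have "(A *\<^sub>v v) $ k x = (\<Sum>j = 0..<n. a x (h j) * v $ j)"
      using hk that by (simp add: A_def scalar_prod_def)
    also have "\<dots> = (\<Sum>j = 0..<n. a x (h j) * v $ k (h j))" by (simp add: kh)
    also have "\<dots> = (\<Sum>y\<in>V. a x y * v $ k y)"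
      by (rule sum.reindex_bij_betw[OF h])
    finally show ?thesis .
  qed
  have "det A \<noteq> 0"
  proof
    assume "det A = 0"
    then obtain v where v: "v \<in> carrier_vec n" "v \<noteq> 0\<^sub>v n" "A *\<^sub>v v = 0\<^sub>v n"
      using det_0_iff_vec_prod_zero_field[OF A] by blast
    have "\<forall>y\<in>V. v $ k y = 0"
      by (rule inj) (use prod[OF _ v(1)] v(3) hk in simp)
    then have "v $ i = 0" if "i < n" for i
      using that kh hV by force
    with v show False by auto
  qed
  from det_non_zero_imp_unit[OF A this, of "()"]
  obtain B where B: "B \<in> carrier_mat n n" "A * B = 1\<^sub>m n"
    by (auto simp: Units_def ring_mat_def)
  define v where "v = B *\<^sub>v vec n (\<lambda>i. c (h i))"
  have v: "v \<in> carrier_vec n" using B by (simp add: v_def)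
  have "A *\<^sub>v v = vec n (\<lambda>i. c (h i))"
    unfolding v_def using A B by (subst assoc_mult_mat_vec[symmetric]) auto
  then have "(\<Sum>y\<in>V. a x y * v $ k y) = c x" if "x \<in> V" for x
    using prod[OF that v] hk[OF that] by simp
  then show ?thesis by (intro exI[of _ "\<lambda>y. v $ k y"] ballI)
qed

text \<open>Trades paths for potentials. To recover paths, test with the indicator function of the
  set of vertices reachable from \<open>x\<close>.\<close>

lemma (in wf_digraph) connected_iff_locally_constant:
  "Digraph_Component.connected G \<longleftrightarrow> verts G \<noteq> {} \<and>
     (\<forall>f :: 'a \<Rightarrow> real. (\<forall>e\<in>arcs G. f (tail G e) = f (head G e)) \<longrightarrow>
        (\<forall>x\<in>verts G. \<forall>y\<in>verts G. f x = f y))"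
  (is "_ \<longleftrightarrow> _ \<and> ?R")
proof -
  let ?r = "(arcs_ends G)\<^sup>s"
  have "(\<forall>x\<in>verts G. \<forall>y\<in>verts G. (x, y) \<in> rtrancl_on (verts G) ?r) \<longleftrightarrow> ?R" (is "?C \<longleftrightarrow> _")
  proof
    assume C: ?C
    show ?R
    proof (intro allI impI ballI)
      fix f :: "'a \<Rightarrow> real" and x y
      assume f: "\<forall>e\<in>arcs G. f (tail G e) = f (head G e)" and "x \<in> verts G" "y \<in> verts G"
      with C have "(x, y) \<in> rtrancl_on (verts G) ?r" by blast
      then show "f x = f y"
        by (induction rule: rtrancl_on_induct)
          (use f in \<open>auto simp: symcl_def arcs_ends_conv\<close>)
    qed
  next
    assume R: ?R
    show ?C
    proof (intro ballI)
      fix x y assume xy: "x \<in> verts G" "y \<in> verts G"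
      define f :: "'a \<Rightarrow> real" where "f z = of_bool ((x, z) \<in> rtrancl_on (verts G) ?r)" for z
      have "\<forall>e\<in>arcs G. f (tail G e) = f (head G e)"
      proof
        fix e assume e: "e \<in> arcs G"
        then have "(tail G e, head G e) \<in> ?r" "(head G e, tail G e) \<in> ?r"
          by (auto simp: symcl_def arcs_ends_conv)
        then show "f (tail G e) = f (head G e)"
          using e unfolding f_def by (auto intro: rtrancl_on_into_rtrancl_on)
      qed
      with R xy have "f x = f y" by blast
      moreover have "f x = 1" using xy by (simp add: f_def)
      ultimately show "(x, y) \<in> rtrancl_on (verts G) ?r" unfolding f_def
        by (metis of_bool_eq_1_iff)
    qed
  qed
  then show ?thesis unfolding connected_conv by blast
qed

definition grad :: "('a, 'b) pre_digraph \<Rightarrow> ('a \<Rightarrow> real) \<Rightarrow> 'b \<Rightarrow> real" where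
  "grad G f e = f (tail G e) - f (head G e)"

lemma sum_mult_of_bool_point:
  fixes f :: "'a \<Rightarrow> real"
  assumes "finite A" "a \<in> A"
  shows "(\<Sum>x\<in>A. f x * of_bool (x = a)) = f a"
  using assms by (simp add: sum.remove[of A a])

lemma (in fin_digraph) outflow_eq_sum_grad:
  "outflow G L f x =
     (\<Sum>e\<in>arcs G. (of_bool (x = tail G e) - of_bool (x = head G e)) * grad G f e / L e)"
proof -
  have "(\<Sum>e\<in>out_arcs G x. (f x - f (head G e)) / L e) =
      (\<Sum>e\<in>arcs G. of_bool (x = tail G e) * grad G f e / L e)"
    by (rule sum.mono_neutral_cong_left) (auto simp: grad_def)
  moreover have "(\<Sum>e\<in>in_arcs G x. (f x - f (tail G e)) / L e) =
      (\<Sum>e\<in>arcs G. - (of_bool (x = head G e) * grad G f e / L e))"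
    by (rule sum.mono_neutral_cong_left) (auto simp: grad_def diff_divide_distrib)
  ultimately show ?thesis
    unfolding outflow_def by (simp add: left_diff_distrib diff_divide_distrib sum_subtractf sum_negf)
qed

text \<open>Summation by parts: the discrete Green identity for the energy pairing of
  \<open>h\<close> and \<open>f\<close>.\<close>

lemma (in fin_digraph) energy_eq_sum_outflow:
  "(\<Sum>e\<in>arcs G. grad G h e * grad G f e / L e) = (\<Sum>x\<in>verts G. h x * outflow G L f x)"
proof -
  have "(\<Sum>x\<in>verts G. h x * outflow G L f x) =
     (\<Sum>e\<in>arcs G. \<Sum>x\<in>verts G. h x * (of_bool (x = tail G e) - of_bool (x = head G e)) * grad G f e / L e)"
    unfolding outflow_eq_sum_grad sum_distrib_left
    by (subst sum.swap) (simp add: algebra_simps)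
  also have "\<dots> = (\<Sum>e\<in>arcs G. grad G h e * grad G f e / L e)"
  proof (rule sum.cong)
    fix e assume e: "e \<in> arcs G"
    have "(\<Sum>x\<in>verts G. h x * (of_bool (x = tail G e) - of_bool (x = head G e))) = grad G h e"
      using e by (simp add: right_diff_distrib sum_subtractf grad_def sum_mult_of_bool_point del: sum_mult_of_bool_eq)
    then show "(\<Sum>x\<in>verts G. h x * (of_bool (x = tail G e) - of_bool (x = head G e)) * grad G f e / L e)
        = grad G h e * grad G f e / L e"
      by (simp flip: sum_distrib_right sum_divide_distrib)
  qed simp
  finally show ?thesis by simp
qed

lemma (in fin_digraph) sum_outflow: "(\<Sum>x\<in>verts G. outflow G L f x) = 0"
  using energy_eq_sum_outflow[of "\<lambda>_. 1" f L] by (simp add: grad_def)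

lemma (in metrized_graph) grad_eq_0_imp_constant:
  assumes "\<And>e. e \<in> arcs G \<Longrightarrow> grad G f e = 0" "x \<in> verts G" "y \<in> verts G"
  shows "f x = f y"
  using connected assms unfolding connected_iff_locally_constant grad_def by force

text \<open>Pairing \<open>f\<close> with itself gives zero energy; each term is nonnegative because
  lengths are positive, so every gradient vanishes.\<close>

lemma (in metrized_graph) outflow_eq_0_imp_constant:
  assumes "\<And>x. x \<in> verts G \<Longrightarrow> outflow G L f x = 0" "x \<in> verts G" "y \<in> verts G"
  shows "f x = f y"
proof (rule grad_eq_0_imp_constant)
  fix e assume e: "e \<in> arcs G"
  have "(\<Sum>e\<in>arcs G. grad G f e * grad G f e / L e) = 0"
    unfolding energy_eq_sum_outflow using assms by simp
  then show "grad G f e = 0"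
    using e length_pos by (subst (asm) sum_nonneg_eq_0_iff) (fastforce simp: less_imp_le)+
qed (use assms in auto)

lemma (in fin_digraph) outflow_diff:
  "outflow G L (\<lambda>x. f x - h x) x = outflow G L f x - outflow G L h x"
  unfolding outflow_eq_sum_grad
  by (simp add: grad_def algebra_simps diff_divide_distrib add_divide_distrib sum_subtractf sum.distrib)

lemma (in fin_digraph) outflow_add:
  "outflow G L (\<lambda>x. f x + h x) x = outflow G L f x + outflow G L h x"
  unfolding outflow_eq_sum_grad
  by (simp add: grad_def algebra_simps diff_divide_distrib add_divide_distrib sum_subtractf sum.distrib)

lemma (in fin_digraph) outflow_scale:
  "outflow G L (\<lambda>x. c * f x) x = c * outflow G L f x"
  unfolding outflow_eq_sum_grad sum_distrib_left
  by (simp add: grad_def algebra_simps diff_divide_distrib)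

lemma (in fin_digraph) outflow_const: "outflow G L (\<lambda>_. c) x = 0"
  unfolding outflow_eq_sum_grad by (simp add: grad_def)

section \<open>The Green function\<close>

text \<open>The pseudo-inverse of the Laplacian. The constant \<open>1 / card (verts G)\<close> is
  forced, since outflows sum to zero; the zero sum of \<open>g y\<close> fixes its additive
  constant.\<close>

definition is_green ::
    "('a, 'b) pre_digraph \<Rightarrow> ('b \<Rightarrow> real) \<Rightarrow> ('a \<Rightarrow> 'a \<Rightarrow> real) \<Rightarrow> bool" where
  "is_green G L g \<longleftrightarrow> (\<forall>y\<in>verts G. (\<Sum>x\<in>verts G. g y x) = 0 \<and>
     (\<forall>x\<in>verts G. outflow G L (g y) x = of_bool (x = y) - 1 / real (card (verts G))))"

text \<open>
  If \<open>g\<close> is a Green function, then \<open>dipole G g i\<close> is the potential of a unit current that enters at the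
  tail and exits at the head of \<open>i\<close>, and \<open>transfer G g e e\<close> is the effective resistance between the
  end points of \<open>e\<close> in \<open>G\<close> itself, not in \<open>G - e\<close>.
\<close>

definition dipole :: "('a, 'b) pre_digraph \<Rightarrow> ('a \<Rightarrow> 'a \<Rightarrow> real) \<Rightarrow> 'b \<Rightarrow> 'a \<Rightarrow> real" where
  "dipole G g i x = g (tail G i) x - g (head G i) x"

definition transfer :: "('a, 'b) pre_digraph \<Rightarrow> ('a \<Rightarrow> 'a \<Rightarrow> real) \<Rightarrow> 'b \<Rightarrow> 'b \<Rightarrow> real" where
  "transfer G g e i = grad G (dipole G g i) e"

text \<open>For a Green function \<open>g\<close>, which is symmetric, this is the effective
  resistance in the graph itself.\<close>

definition resistance :: "('a \<Rightarrow> 'a \<Rightarrow> real) \<Rightarrow> 'a \<Rightarrow> 'a \<Rightarrow> real" where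
  "resistance g y x = g y y + g x x - 2 * g y x"

text \<open>The Sherman--Morrison formula for the Laplacian of \<open>G - i\<close>.\<close>

definition green_del ::
    "('a, 'b) pre_digraph \<Rightarrow> ('b \<Rightarrow> real) \<Rightarrow> ('a \<Rightarrow> 'a \<Rightarrow> real) \<Rightarrow> 'b \<Rightarrow> 'a \<Rightarrow> 'a \<Rightarrow> real" where
  "green_del G L g i y x =
     g y x + dipole G g i y * dipole G g i x / (L i - transfer G g i i)"

definition dipole_sq ::
    "('a, 'b) pre_digraph \<Rightarrow> ('a \<Rightarrow> 'a \<Rightarrow> real) \<Rightarrow> 'a \<Rightarrow> 'b \<Rightarrow> 'a \<Rightarrow> real" where
  "dipole_sq G g p i x = (dipole G g i x - dipole G g i p)\<^sup>2"

lemma grad_del_arc [simp]: "grad (pre_digraph.del_arc G i) f e = grad G f e"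
  by (simp add: grad_def pre_digraph.del_arc_simps)

lemma transfer_green_del:
  "transfer (pre_digraph.del_arc G i) (green_del G L g i) e e =
     transfer G g e e + (transfer G g e i)\<^sup>2 / (L i - transfer G g i i)"
  by (simp add: transfer_def grad_def dipole_def green_del_def pre_digraph.del_arc_simps
      power2_eq_square algebra_simps add_divide_distrib diff_divide_distrib)

lemma resistance_green_del:
  "resistance (green_del G L g i) p x =
     resistance g p x + dipole_sq G g p i x / (L i - transfer G g i i)"
  by (simp add: resistance_def green_del_def dipole_sq_def
      power2_eq_square algebra_simps add_divide_distrib diff_divide_distrib)

lemma grad_resistance_green_del:
  "grad G (resistance (green_del G L g i) p) e =
     grad G (resistance g p) e + grad G (dipole_sq G g p i) e / (L i - transfer G g i i)"
  by (simp add: grad_def resistance_green_del diff_divide_distrib)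

context metrized_graph
begin

lemma verts_nonempty: "verts G \<noteq> {}"
  using connected connected_iff_locally_constant by blast

lemma card_verts_pos: "card (verts G) > 0"
  using verts_nonempty finite_verts by (simp add: card_gt_0_iff)

text \<open>The Laplacian plus the all-ones matrix is invertible.\<close>

lemma ex_green: obtains g where "is_green G L g"
proof -
  let ?a = "\<lambda>x y. outflow G L (\<lambda>z. of_bool (z = y)) x + 1"
  have lin: "(\<Sum>y\<in>verts G. ?a x y * f y) = outflow G L f x + (\<Sum>y\<in>verts G. f y)" for f x
  proof -
    have "(\<Sum>y\<in>verts G. outflow G L (\<lambda>z. of_bool (z = y)) x * f y) =
       (\<Sum>e\<in>arcs G. \<Sum>y\<in>verts G. (of_bool (x = tail G e) - of_bool (x = head G e)) *
          (of_bool (tail G e = y) * f y - of_bool (head G e = y) * f y) / L e)"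
      unfolding outflow_eq_sum_grad sum_distrib_right
      by (subst sum.swap) (simp add: grad_def algebra_simps)
    also have "\<dots> = outflow G L f x"
      unfolding outflow_eq_sum_grad
      by (intro sum.cong refl) (simp add: grad_def sum_subtractf flip: sum_distrib_left sum_divide_distrib)
    finally show ?thesis by (simp add: ring_distribs sum.distrib)
  qed
  have "\<exists>f. \<forall>x\<in>verts G. (\<Sum>z\<in>verts G. ?a x z * f z) = of_bool (x = y) - 1 / real (card (verts G))" for y
  proof -
    have "\<forall>y\<in>verts G. f y = 0" if f: "\<And>x. x \<in> verts G \<Longrightarrow> (\<Sum>y\<in>verts G. ?a x y * f y) = 0" for f
    proof -
      \<comment> \<open>Summing over all vertices removes the Laplacian and leaves
        \<open>card (verts G)\<close> times the sum of \<open>f\<close>.\<close>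
      from f have "(\<Sum>x\<in>verts G. outflow G L f x + (\<Sum>y\<in>verts G. f y)) = 0"
        unfolding lin by simp
      then have s: "(\<Sum>y\<in>verts G. f y) = 0"
        using verts_nonempty by (simp add: sum.distrib sum_outflow)
      have c: "f x = f y" if "x \<in> verts G" "y \<in> verts G" for x y
        by (rule outflow_eq_0_imp_constant) (use f s lin that in auto)
      show "\<forall>y\<in>verts G. f y = 0"
      proof
        fix y assume y: "y \<in> verts G"
        have "(\<Sum>x\<in>verts G. f x) = (\<Sum>x\<in>verts G. f y)" by (intro sum.cong refl c y)
        then show "f y = 0" using s verts_nonempty by simp
      qed
    qed
    then show ?thesis by (rule injective_imp_solvable[OF finite_verts])
  qed
  then have "\<exists>g. \<forall>y. \<forall>x\<in>verts G.
      (\<Sum>z\<in>verts G. ?a x z * g y z) = of_bool (x = y) - 1 / real (card (verts G))"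
    by (intro choice allI)
  then obtain g where g: "\<And>x y. x \<in> verts G \<Longrightarrow>
      (\<Sum>z\<in>verts G. ?a x z * g y z) = of_bool (x = y) - 1 / real (card (verts G))"
    by blast
  have "is_green G L g" unfolding is_green_def
  proof (intro ballI conjI)
    fix y assume y: "y \<in> verts G"
    have "(\<Sum>x\<in>verts G. outflow G L (g y) x + (\<Sum>z\<in>verts G. g y z)) =
        (\<Sum>x\<in>verts G. of_bool (x = y) - 1 / real (card (verts G)))"
      by (intro sum.cong refl) (use g in \<open>simp add: lin\<close>)
    also have "\<dots> = 0" using y verts_nonempty by (simp add: sum_subtractf)
    finally show s: "(\<Sum>x\<in>verts G. g y x) = 0"
      using verts_nonempty by (simp add: sum.distrib sum_outflow)
    fix x assume "x \<in> verts G"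
    then show "outflow G L (g y) x = of_bool (x = y) - 1 / real (card (verts G))"
      using g[of x y] s by (simp add: lin)
  qed
  then show ?thesis by (rule that)
qed

lemma outflow_del_arc:
  assumes "i \<in> arcs G"
  shows "outflow (del_arc i) L f x =
    outflow G L f x - (of_bool (x = tail G i) - of_bool (x = head G i)) * grad G f i / L i"
proof -
  interpret D: fin_digraph "del_arc i" by (rule fin_digraph_del_arc)
  show ?thesis
    unfolding outflow_eq_sum_grad D.outflow_eq_sum_grad using assms
    by (simp add: sum_diff1)
qed

lemma metrized_graph_del_arc:
  assumes "i \<in> arcs G" "\<not> bridge G i"
  shows "metrized_graph (del_arc i) L"
  using assms fin_digraph_del_arc length_pos
  by (auto simp: metrized_graph_def metrized_graph_axioms_def bridge_def)

context
  fixes g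
  assumes green: "is_green G L g"
begin

section \<open>Energy identities, reciprocity and Foster's theorem\<close>

lemma sum_green: "y \<in> verts G \<Longrightarrow> (\<Sum>x\<in>verts G. g y x) = 0"
  using green by (simp add: is_green_def)

lemma outflow_green:
  "\<lbrakk>y \<in> verts G; x \<in> verts G\<rbrakk> \<Longrightarrow>
    outflow G L (g y) x = of_bool (x = y) - 1 / real (card (verts G))"
  using green by (simp add: is_green_def)

text \<open>Reproducing property: pairing with \<open>g y\<close> evaluates at \<open>y\<close>, up
  to the mean.\<close>

lemma energy_green:
  assumes y: "y \<in> verts G"
  shows "(\<Sum>e\<in>arcs G. grad G h e * grad G (g y) e / L e) =
    h y - (\<Sum>x\<in>verts G. h x) / real (card (verts G))"
proof -
  have "(\<Sum>e\<in>arcs G. grad G h e * grad G (g y) e / L e) =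
      (\<Sum>x\<in>verts G. h x * of_bool (x = y) - h x / real (card (verts G)))"
    unfolding energy_eq_sum_outflow
    by (intro sum.cong refl) (simp add: outflow_green[OF y] right_diff_distrib)
  also have "\<dots> = h y - (\<Sum>x\<in>verts G. h x) / real (card (verts G))"
    using y by (simp add: sum_subtractf sum_divide_distrib sum_mult_of_bool_point del: sum_mult_of_bool_eq)
  finally show ?thesis .
qed

text \<open>The energy pairing of \<open>g x\<close> and \<open>g y\<close> is symmetric, and their
  zero sums remove the means in \<open>energy_green\<close>.\<close>

lemma green_sym: "\<lbrakk>x \<in> verts G; y \<in> verts G\<rbrakk> \<Longrightarrow> g x y = g y x"
  using energy_green[of y "g x"] energy_green[of x "g y"] sum_green[of x] sum_green[of y]
  by (simp add: mult.commute)

lemma outflow_dipole: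
  assumes "i \<in> arcs G" "x \<in> verts G"
  shows "outflow G L (dipole G g i) x = of_bool (x = tail G i) - of_bool (x = head G i)"
  unfolding dipole_def outflow_diff using assms by (simp add: outflow_green)

text \<open>The dipole reproduces voltages across \<open>i\<close>. With \<open>h\<close> the dipole
  itself this yields \<open>energy_transfer\<close>, with its normalised cube
  \<open>energy_dipole_cube\<close>.\<close>

lemma energy_dipole:
  assumes "i \<in> arcs G"
  shows "(\<Sum>e\<in>arcs G. grad G h e * transfer G g e i / L e) = grad G h i"
  unfolding transfer_def energy_eq_sum_outflow using assms
  by (simp add: outflow_dipole right_diff_distrib sum_subtractf grad_def sum_mult_of_bool_point
      del: sum_mult_of_bool_eq)

lemma transfer_sym: "\<lbrakk>e \<in> arcs G; i \<in> arcs G\<rbrakk> \<Longrightarrow> transfer G g e i = transfer G g i e"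
  using green_sym[of "tail G e" "tail G i"] green_sym[of "head G e" "tail G i"]
    green_sym[of "tail G e" "head G i"] green_sym[of "head G e" "head G i"]
  by (simp add: transfer_def grad_def dipole_def)

lemma energy_transfer: "i \<in> arcs G \<Longrightarrow> (\<Sum>e\<in>arcs G. (transfer G g e i)\<^sup>2 / L e) = transfer G g i i"
  using energy_dipole[of i "dipole G g i"] by (simp add: transfer_def power2_eq_square)

text \<open>Reciprocity moves the sum to the second index, as needed when the deleted edge
  varies.\<close>

lemma energy_transfer':
  assumes e: "e \<in> arcs G"
  shows "(\<Sum>i\<in>arcs G. (transfer G g e i)\<^sup>2 / L i) = transfer G g e e"
proof -
  have "(\<Sum>i\<in>arcs G. (transfer G g e i)\<^sup>2 / L i) = (\<Sum>i\<in>arcs G. (transfer G g i e)\<^sup>2 / L i)"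
    by (intro sum.cong refl) (simp only: transfer_sym[OF e])
  then show ?thesis using energy_transfer[OF e] by simp
qed

lemma transfer_self: "e \<in> arcs G \<Longrightarrow> transfer G g e e = resistance g (tail G e) (head G e)"
  using green_sym[of "head G e" "tail G e"]
  by (simp add: transfer_def grad_def dipole_def resistance_def)

text \<open>The trace of the Laplacian applied to \<open>g\<close>, computed once by edges and once
  by vertices.\<close>

lemma foster:
  "(\<Sum>e\<in>arcs G. transfer G g e e / L e) = real (card (verts G)) - 1"
proof -
  have "(\<Sum>y\<in>verts G. outflow G L (g y) y) =
     (\<Sum>e\<in>arcs G. \<Sum>y\<in>verts G. (of_bool (y = tail G e) - of_bool (y = head G e)) * grad G (g y) e / L e)"
    unfolding outflow_eq_sum_grad by (subst sum.swap) simp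
  also have "\<dots> = (\<Sum>e\<in>arcs G. transfer G g e e / L e)"
  proof (intro sum.cong refl)
    fix e assume e: "e \<in> arcs G"
    have "(\<Sum>y\<in>verts G. (of_bool (y = tail G e) - of_bool (y = head G e)) * grad G (g y) e)
        = grad G (g (tail G e)) e - grad G (g (head G e)) e"
      using e by (simp add: left_diff_distrib sum_subtractf)
    also have "\<dots> = transfer G g e e"
      by (simp add: transfer_def grad_def dipole_def)
    finally show "(\<Sum>y\<in>verts G. (of_bool (y = tail G e) - of_bool (y = head G e)) * grad G (g y) e / L e)
        = transfer G g e e / L e"
      by (simp flip: sum_divide_distrib)
  qed
  also have "(\<Sum>y\<in>verts G. outflow G L (g y) y) = real (card (verts G)) - 1"
    using card_verts_pos verts_nonempty by (simp add: outflow_green field_simps)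
  finally show ?thesis by simp
qed

section \<open>Voltages and bridges through the Green function\<close>

lemma is_potential_green:
  assumes "y \<in> verts G" "z \<in> verts G"
  shows "is_potential G L z y (\<lambda>x. g y x - g z x - (g y z - g z z))"
  unfolding is_potential_def outflow_diff outflow_const using assms by (simp add: outflow_green)

text \<open>Two potentials differ by a function without outflow, hence by a constant, which vanishes
  at \<open>z\<close>.\<close>

lemma voltage_eq:
  assumes x: "x \<in> verts G" and y: "y \<in> verts G" and z: "z \<in> verts G"
  shows "voltage G L z x y = g y x - g z x - (g y z - g z z)"
  unfolding voltage_def
proof (rule the_equality)
  let ?h = "\<lambda>x. g y x - g z x - (g y z - g z z)"
  show "\<exists>f. is_potential G L z y f \<and> ?h x = f x"
    using is_potential_green[OF y z] by blast
  fix t assume "\<exists>f. is_potential G L z y f \<and> t = f x"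
  then obtain f where f: "is_potential G L z y f" "t = f x" by blast
  have "f x - ?h x = f z - ?h z"
  proof (rule outflow_eq_0_imp_constant[where f = "\<lambda>x. f x - ?h x"])
    fix v assume "v \<in> verts G"
    then show "outflow G L (\<lambda>x. f x - ?h x) v = 0"
      unfolding outflow_diff[of L f ?h] using f(1) is_potential_green[OF y z]
      by (simp add: is_potential_def)
  qed (use x z in auto)
  then show "t = ?h x" using f by (simp add: is_potential_def)
qed

text \<open>The term of \<open>e\<close> alone already exhausts the total in
  \<open>energy_transfer\<close>, so no current flows through any other edge.\<close>

lemma dipole_locally_constant:
  assumes e: "e \<in> arcs G" and K: "transfer G g e e = L e" and i: "i \<in> arcs G" "i \<noteq> e"
  shows "dipole G g e (tail G i) = dipole G g e (head G i)"
proof -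
  have "(\<Sum>i\<in>arcs G - {e}. (transfer G g i e)\<^sup>2 / L i) = 0"
    using energy_transfer[OF e] e K length_pos[OF e]
    by (subst (asm) sum.remove[of _ e]) (auto simp: power2_eq_square)
  then have "\<forall>i\<in>arcs G - {e}. (transfer G g i e)\<^sup>2 / L i = 0"
    by (subst (asm) sum_nonneg_eq_0_iff) (auto simp: length_pos less_imp_le)
  then show ?thesis
    using i length_pos[OF i(1)] by (auto simp: transfer_def grad_def)
qed

text \<open>Equality means that the whole unit current passes through \<open>e\<close>. For a
  bridge, pair the dipole with a nonconstant function that is locally constant off \<open>e\<close>:
  only the term of \<open>e\<close> survives. Conversely, if \<open>G - e\<close> were connected,
  the dipole would be constant.\<close>

lemma bridge_iff:
  assumes e: "e \<in> arcs G"
  shows "bridge G e \<longleftrightarrow> transfer G g e e = L e"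
proof
  interpret D: fin_digraph "del_arc e" by (rule fin_digraph_del_arc)
  have L: "L e > 0" using e by (rule length_pos)
  {
    assume "bridge G e"
    then obtain f x y where f: "\<forall>i\<in>arcs G - {e}. grad G f i = 0" and
      xy: "x \<in> verts G" "y \<in> verts G" "f x \<noteq> f y"
      using verts_nonempty unfolding bridge_def D.connected_iff_locally_constant
      by (auto simp: grad_def)
    have "grad G f e \<noteq> 0"
    proof
      assume "grad G f e = 0"
      then have "grad G f i = 0" if "i \<in> arcs G" for i using f that by (cases "i = e") auto
      then show False using grad_eq_0_imp_constant xy by blast
    qed
    moreover have "grad G f e = grad G f e * transfer G g e e / L e"
      using energy_dipole[OF e, of f] e f by (subst (asm) sum.remove[of _ e]) auto
    ultimately show "transfer G g e e = L e" using L by (simp add: field_simps)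
  next
    assume K: "transfer G g e e = L e"
    show "bridge G e" unfolding bridge_def
    proof (intro conjI notI e)
      assume "Digraph_Component.connected (del_arc e)"
      with dipole_locally_constant[OF e K] have "\<forall>x\<in>verts G. \<forall>y\<in>verts G. dipole G g e x = dipole G g e y"
        unfolding D.connected_iff_locally_constant by simp
      with e have "dipole G g e (tail G e) = dipole G g e (head G e)"
        by simp
      with K L show False by (simp add: transfer_def grad_def)
    qed
  }
qed

section \<open>Deleting an edge\<close>

lemma is_green_green_del:
  assumes i: "i \<in> arcs G" and nb: "\<not> bridge G i"
  shows "is_green (del_arc i) L (green_del G L g i)"
  unfolding is_green_def verts_del_arc
proof (intro ballI conjI)
  let ?u = "dipole G g i" and ?c = "L i - transfer G g i i"
  have nz: "?c \<noteq> 0" "L i \<noteq> 0"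
    using bridge_iff[OF i] nb length_pos[OF i] by auto
  fix y assume y: "y \<in> verts G"
  have gd: "green_del G L g i y = (\<lambda>x. g y x + ?u y / ?c * ?u x)"
    by (simp add: green_del_def fun_eq_iff)
  have "(\<Sum>x\<in>verts G. ?u x) = 0"
    using i by (simp add: dipole_def sum_subtractf sum_green)
  then show "(\<Sum>x\<in>verts G. green_del G L g i y x) = 0"
    unfolding gd by (simp add: sum.distrib sum_green[OF y] flip: sum_distrib_left sum_divide_distrib)
  fix x assume x: "x \<in> verts G"
  have gr: "grad G (\<lambda>x. g y x + c * ?u x) i = ?u y + c * transfer G g i i" for c
    using i y green_sym[of y "tail G i"] green_sym[of y "head G i"]
    by (simp add: grad_def transfer_def dipole_def algebra_simps)
  \<comment> \<open>The coefficient \<open>?u y / ?c\<close> is chosen so that the added dipole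
    makes up exactly for the current lost with \<open>i\<close>.\<close>
  have "?u y + ?u y / ?c * transfer G g i i = ?u y / ?c * L i"
    using nz by (simp add: field_simps)
  then show "outflow (del_arc i) L (green_del G L g i y) x = of_bool (x = y) - 1 / real (card (verts G))"
    unfolding gd outflow_del_arc[OF i] gr outflow_add outflow_scale outflow_dipole[OF i x]
      outflow_green[OF y x]
    using nz by simp
qed

text \<open>Factor the difference of squares: the normalised dipole values at the ends of
  \<open>i\<close> have difference \<open>transfer G g i i\<close> and, by symmetry of
  \<open>g\<close>, sum \<open>grad G (resistance g p) i\<close>.\<close>

lemma grad_dipole_sq_self:
  assumes "i \<in> arcs G" "p \<in> verts G"
  shows "grad G (dipole_sq G g p i) i = transfer G g i i * grad G (resistance g p) i"
  using assms green_sym[of "tail G i" "head G i"]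
    green_sym[of p "tail G i"] green_sym[of p "head G i"]
  by (simp add: grad_def dipole_sq_def dipole_def transfer_def resistance_def power2_eq_square algebra_simps)

section \<open>The invariants as sums over data of the undeleted graph\<close>

text \<open>The parallel law \<open>K = L R / (L + R)\<close> solved for \<open>R\<close>, where
  \<open>K = transfer G g e e\<close>.\<close>

lemma R_eq:
  assumes e: "e \<in> arcs G" and nb: "\<not> bridge G e"
  shows "R G L e = transfer G g e e * L e / (L e - transfer G g e e)"
proof -
  interpret D: metrized_graph "del_arc e" L by (rule metrized_graph_del_arc[OF e nb])
  note gr = is_green_green_del[OF e nb]
  have "R G L e = resistance (green_del G L g e) (tail G e) (head G e)"
    using e D.voltage_eq[OF gr] D.green_sym[OF gr, of "head G e" "tail G e"]
    by (simp add: R_def effective_resistance_def resistance_def)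
  also have "\<dots> = transfer G g e e + (transfer G g e e)\<^sup>2 / (L e - transfer G g e e)"
  proof -
    have "dipole_sq G g (tail G e) e (head G e) = (transfer G g e e)\<^sup>2"
      by (simp add: dipole_sq_def transfer_def grad_def power2_commute)
    then show ?thesis unfolding resistance_green_del transfer_self[OF e, symmetric] by simp
  qed
  also have "\<dots> = transfer G g e e * L e / (L e - transfer G g e e)"
    using bridge_iff[OF e] nb by (simp add: field_simps power2_eq_square)
  finally show ?thesis .
qed

text \<open>The left side is the difference of the resistances from \<open>p\<close> to the ends of
  \<open>e\<close> in \<open>G - e\<close>; \<open>grad_dipole_sq_self\<close> evaluates the
  perturbation.\<close>

lemma Ra_minus_Rb_eq:
  assumes e: "e \<in> arcs G" and nb: "\<not> bridge G e" and p: "p \<in> verts G"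
  shows "Ra G L p e - Rb G L p e = L e * grad G (resistance g p) e / (L e - transfer G g e e)"
proof -
  interpret D: metrized_graph "del_arc e" L by (rule metrized_graph_del_arc[OF e nb])
  note gr = is_green_green_del[OF e nb]
  have "Ra G L p e - Rb G L p e = grad G (resistance (green_del G L g e) p) e"
    using e p D.voltage_eq[OF gr] D.green_sym[OF gr, of "head G e" "tail G e"]
      D.green_sym[OF gr, of p "tail G e"] D.green_sym[OF gr, of p "head G e"]
    by (simp add: Ra_def Rb_def resistance_def grad_def)
  also have "\<dots> = grad G (resistance g p) e + transfer G g e e * grad G (resistance g p) e / (L e - transfer G g e e)"
    by (simp add: grad_resistance_green_del grad_dipole_sq_self e p)
  also have "\<dots> = L e * grad G (resistance g p) e / (L e - transfer G g e e)"
    using bridge_iff[OF e] nb by (simp add: field_simps)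
  finally show ?thesis .
qed

text \<open>Off a bridge \<open>e\<close>, the dipole potential of \<open>e\<close> is locally constant, so it takes only two values.\<close>

lemma grad_resistance_bridge:
  assumes e: "e \<in> arcs G" and b: "bridge G e" and p: "p \<in> verts G"
  shows "(grad G (resistance g p) e)\<^sup>2 = (L e)\<^sup>2"
proof -
  let ?u = "\<lambda>x. dipole G g e x - dipole G g e p"
  \<comment> \<open>This product vanishes at both ends of \<open>e\<close> and is constant along
    every other edge, so it vanishes at \<open>p\<close>, where \<open>?u\<close> is
    \<open>0\<close>. Hence \<open>?u\<close> is \<open>0\<close> at one end of
    \<open>e\<close>.\<close>
  let ?f = "\<lambda>x. (?u x - ?u (tail G e)) * (?u x - ?u (head G e))"
  have K: "transfer G g e e = L e" using bridge_iff[OF e] b by simp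
  have L: "L e > 0" using e by (rule length_pos)
  have "?f p = ?f (tail G e)"
  proof (rule grad_eq_0_imp_constant)
    fix i assume i: "i \<in> arcs G"
    show "grad G ?f i = 0"
    proof (cases "i = e")
      case False
      then have "dipole G g e (tail G i) = dipole G g e (head G i)"
        using dipole_locally_constant[OF e K i] by simp
      then show ?thesis by (simp add: grad_def)
    qed (simp add: grad_def)
  qed (use e p in auto)
  then have prod: "?u (tail G e) * ?u (head G e) = 0" by auto
  have D: "transfer G g e e * grad G (resistance g p) e = (?u (tail G e))\<^sup>2 - (?u (head G e))\<^sup>2"
    unfolding grad_dipole_sq_self[OF e p, symmetric] by (simp add: grad_def dipole_sq_def)
  have K2: "?u (tail G e) - ?u (head G e) = L e"
    using K by (simp add: transfer_def grad_def)
  have "L e * grad G (resistance g p) e = L e * (?u (tail G e) + ?u (head G e))"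
    using D unfolding K by (simp add: power2_eq_square algebra_simps flip: K2)
  then have sum: "grad G (resistance g p) e = ?u (tail G e) + ?u (head G e)"
    using L by simp
  have "(grad G (resistance g p) e)\<^sup>2 =
      (?u (tail G e) - ?u (head G e))\<^sup>2 + 4 * (?u (tail G e) * ?u (head G e))"
    unfolding sum by (simp add: power2_eq_square algebra_simps)
  then show ?thesis unfolding prod K2 by simp
qed

text \<open>At a bridge \<open>transfer G g e e\<close> is \<open>L e\<close> and the squared
  gradient is its square, so one formula \<open>\<phi>\<close> covers both cases if it takes the
  limit value there.\<close>

lemma edge_sum_eq:
  assumes p: "p \<in> verts G"
    and lim: "\<And>l. l > 0 \<Longrightarrow> ((\<lambda>r. F l r (r\<^sup>2)) \<longlongrightarrow> \<phi> l l (l\<^sup>2)) at_top"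
    and fin: "\<And>l k d. \<lbrakk>l > 0; k \<noteq> l\<rbrakk> \<Longrightarrow> F l (k * l / (l - k)) ((l * d / (l - k))\<^sup>2) = \<phi> l k (d\<^sup>2)"
  shows "edge_sum G L p F = (\<Sum>e\<in>arcs G. \<phi> (L e) (transfer G g e e) ((grad G (resistance g p) e)\<^sup>2))"
  unfolding edge_sum_def
proof (intro sum.cong refl)
  fix e assume e: "e \<in> arcs G"
  show "(if bridge G e then Lim at_top (\<lambda>r. F (L e) r (r\<^sup>2))
      else F (L e) (R G L e) ((Ra G L p e - Rb G L p e)\<^sup>2)) =
      \<phi> (L e) (transfer G g e e) ((grad G (resistance g p) e)\<^sup>2)"
  proof (cases "bridge G e")
    case True
    then show ?thesis
      using tendsto_Lim[OF _ lim[OF length_pos[OF e]]] bridge_iff[OF e]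
      by (simp add: grad_resistance_bridge e p)
  next
    case False
    then show ?thesis
      using fin[OF length_pos[OF e]] bridge_iff[OF e]
      by (simp add: R_eq Ra_minus_Rb_eq e p)
  qed
qed

lemma edge_sums:
  assumes p: "p \<in> verts G"
  shows "edge_sum G L p (\<lambda>l r d. l * r\<^sup>2 / (l + r)\<^sup>2) = (\<Sum>e\<in>arcs G. (transfer G g e e)\<^sup>2 / L e)"
    and "edge_sum G L p (\<lambda>l r d. l * d / (l + r)\<^sup>2) = (\<Sum>e\<in>arcs G. (grad G (resistance g p) e)\<^sup>2 / L e)"
    and "edge_sum G L p (\<lambda>l r d. l\<^sup>2 * r / (l + r)\<^sup>2) =
      (\<Sum>e\<in>arcs G. transfer G g e e - (transfer G g e e)\<^sup>2 / L e)"
proof -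
  have sq: "l\<^sup>2 / l = l" for l :: real
    by (simp add: power2_eq_square)
  \<comment> \<open>The limits stay unsimplified to match \<open>\<phi> l l (l\<^sup>2)\<close>;
    \<open>lim1\<close> serves two sums, which agree for \<open>d = r\<^sup>2\<close>.\<close>
  have lim1: "((\<lambda>r. l * r\<^sup>2 / (l + r)\<^sup>2) \<longlongrightarrow> l\<^sup>2 / l) at_top" if "l > 0" for l :: real
    unfolding sq using that by real_asymp
  have lim2: "((\<lambda>r. l\<^sup>2 * r / (l + r)\<^sup>2) \<longlongrightarrow> l - l\<^sup>2 / l) at_top" if "l > 0" for l :: real
    unfolding sq using that by real_asymp
  \<comment> \<open>This is \<open>L + R\<close> after \<open>R_eq\<close>.\<close>
  have s: "l + k * l / (l - k) = l\<^sup>2 / (l - k)" if "l > 0" "k \<noteq> l" for l k :: real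
    using that by (simp add: field_simps power2_eq_square)
  show "edge_sum G L p (\<lambda>l r d. l * r\<^sup>2 / (l + r)\<^sup>2) = (\<Sum>e\<in>arcs G. (transfer G g e e)\<^sup>2 / L e)"
  proof (rule edge_sum_eq[OF p, where \<phi> = "\<lambda>l k d. k\<^sup>2 / l"])
    show "l * (k * l / (l - k))\<^sup>2 / (l + k * l / (l - k))\<^sup>2 = k\<^sup>2 / l" if "l > 0" "k \<noteq> l" for l k :: real
      unfolding s[OF that] using that by (simp add: power2_eq_square divide_simps)
  qed (rule lim1)
  show "edge_sum G L p (\<lambda>l r d. l * d / (l + r)\<^sup>2) = (\<Sum>e\<in>arcs G. (grad G (resistance g p) e)\<^sup>2 / L e)"
  proof (rule edge_sum_eq[OF p, where \<phi> = "\<lambda>l k d. d / l"])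
    show "l * (l * d / (l - k))\<^sup>2 / (l + k * l / (l - k))\<^sup>2 = d\<^sup>2 / l" if "l > 0" "k \<noteq> l" for l k d :: real
      unfolding s[OF that] using that by (simp add: power2_eq_square divide_simps)
  qed (rule lim1)
  show "edge_sum G L p (\<lambda>l r d. l\<^sup>2 * r / (l + r)\<^sup>2) =
      (\<Sum>e\<in>arcs G. transfer G g e e - (transfer G g e e)\<^sup>2 / L e)"
  proof (rule edge_sum_eq[OF p, where \<phi> = "\<lambda>l k d. k - k\<^sup>2 / l"])
    show "l\<^sup>2 * (k * l / (l - k)) / (l + k * l / (l - k))\<^sup>2 = k - k\<^sup>2 / l" if "l > 0" "k \<noteq> l" for l k :: real
      unfolding s[OF that] using that by (simp add: power2_eq_square divide_simps) (simp add: algebra_simps)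
  qed (rule lim2)
qed

lemma y_inv_eq:
  assumes "p \<in> verts G"
  shows "y_inv G L p =
    (\<Sum>e\<in>arcs G. ((transfer G g e e)\<^sup>2 + 3 * (grad G (resistance g p) e)\<^sup>2) / L e) / 4"
  unfolding y_inv_def edge_sums[OF assms]
  by (simp add: add_divide_distrib sum.distrib flip: sum_distrib_left times_divide_eq_right)

lemma x_inv_eq:
  assumes "p \<in> verts G"
  shows "x_inv G L p = (\<Sum>e\<in>arcs G. transfer G g e e) - y_inv G L p"
  unfolding x_inv_def y_inv_def edge_sums[OF assms] by (simp add: sum_subtractf)

text \<open>Up to a constant, \<open>resistance g p\<close> is the diagonal of \<open>g\<close>
  minus \<open>2 * g p\<close>. By \<open>energy_green\<close> the terms \<open>g p p\<close>
  cancel, which gives independence of the base point.\<close>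

lemma energy_resistance:
  assumes p: "p \<in> verts G"
  shows "(\<Sum>e\<in>arcs G. (grad G (resistance g p) e)\<^sup>2 / L e) =
    (\<Sum>e\<in>arcs G. (grad G (\<lambda>x. g x x) e)\<^sup>2 / L e) + 4 * (\<Sum>x\<in>verts G. g x x) / real (card (verts G))"
proof -
  let ?d = "\<lambda>x. g x x"
  have gr: "grad G (resistance g p) e = grad G ?d e - 2 * grad G (g p) e" for e
    by (simp add: grad_def resistance_def)
  have "(\<Sum>e\<in>arcs G. (grad G (resistance g p) e)\<^sup>2 / L e) =
      (\<Sum>e\<in>arcs G. (grad G ?d e)\<^sup>2 / L e - 4 * (grad G ?d e * grad G (g p) e / L e)
         + 4 * (grad G (g p) e * grad G (g p) e / L e))"
    unfolding gr
    by (intro sum.cong refl)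
      (simp add: power2_eq_square algebra_simps add_divide_distrib diff_divide_distrib)
  also have "\<dots> = (\<Sum>e\<in>arcs G. (grad G ?d e)\<^sup>2 / L e)
      - 4 * (\<Sum>e\<in>arcs G. grad G ?d e * grad G (g p) e / L e)
      + 4 * (\<Sum>e\<in>arcs G. grad G (g p) e * grad G (g p) e / L e)"
    by (simp only: sum.distrib sum_subtractf sum_distrib_left)
  finally show ?thesis
    unfolding energy_green[OF p] by (simp add: sum_green[OF p])
qed

lemma y_inv_base_indep:
  assumes "p \<in> verts G" "q \<in> verts G"
  shows "y_inv G L p = y_inv G L q"
  unfolding y_inv_def edge_sums[OF assms(1)] edge_sums[OF assms(2)]
    energy_resistance[OF assms(1)] energy_resistance[OF assms(2)] ..

section \<open>Identities for sums over the deleted edge\<close>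

text \<open>By reciprocity the dipole difference is the voltage across \<open>i\<close> of a unit
  current from \<open>x\<close> to \<open>p\<close>; the energy of that current is the
  resistance.\<close>

lemma sum_dipole_sq:
  assumes p: "p \<in> verts G" and x: "x \<in> verts G"
  shows "(\<Sum>i\<in>arcs G. dipole_sq G g p i x / L i) = resistance g p x"
proof -
  let ?f = "\<lambda>v. g x v - g p v"
  have "(\<Sum>i\<in>arcs G. dipole_sq G g p i x / L i) = (\<Sum>i\<in>arcs G. grad G ?f i * grad G ?f i / L i)"
  proof (intro sum.cong refl)
    fix i assume "i \<in> arcs G"
    then have "dipole G g i x - dipole G g i p = grad G ?f i"
      using p x green_sym[of _ x] green_sym[of _ p]
      by (simp add: dipole_def grad_def)
    then show "dipole_sq G g p i x / L i = grad G ?f i * grad G ?f i / L i"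
      by (simp add: dipole_sq_def power2_eq_square)
  qed
  also have "\<dots> = (\<Sum>v\<in>verts G. ?f v * (of_bool (v = x) - of_bool (v = p)))"
    unfolding energy_eq_sum_outflow outflow_diff
    by (intro sum.cong refl) (simp add: outflow_green[OF p] outflow_green[OF x])
  also have "\<dots> = ?f x - ?f p"
    using p x by (simp add: right_diff_distrib sum_subtractf sum_mult_of_bool_point del: sum_mult_of_bool_eq)
  also have "\<dots> = resistance g p x"
    using green_sym[OF x p] by (simp add: resistance_def)
  finally show ?thesis .
qed

text \<open>Interchange the sums and apply \<open>sum_dipole_sq\<close> at both ends of
  \<open>e\<close>.\<close>

lemma sum_energy_resistance_dipole_sq:
  assumes p: "p \<in> verts G"
  shows "(\<Sum>i\<in>arcs G. (\<Sum>e\<in>arcs G. grad G (resistance g p) e * grad G (dipole_sq G g p i) e / L e) / L i) =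
    (\<Sum>e\<in>arcs G. (grad G (resistance g p) e)\<^sup>2 / L e)"
proof -
  have "(\<Sum>i\<in>arcs G. grad G (dipole_sq G g p i) e / L i) = grad G (resistance g p) e"
    if "e \<in> arcs G" for e
    using that p by (simp add: grad_def diff_divide_distrib sum_subtractf sum_dipole_sq)
  then have "(\<Sum>e\<in>arcs G. (grad G (resistance g p) e)\<^sup>2 / L e) =
      (\<Sum>e\<in>arcs G. grad G (resistance g p) e * (\<Sum>i\<in>arcs G. grad G (dipole_sq G g p i) e / L i) / L e)"
    by (simp add: power2_eq_square)
  also have "\<dots> = (\<Sum>e\<in>arcs G. \<Sum>i\<in>arcs G. grad G (resistance g p) e * grad G (dipole_sq G g p i) e / L e / L i)"
    unfolding sum_distrib_left sum_divide_distrib by (intro sum.cong refl) simp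
  finally show ?thesis by (subst (asm) sum.swap) (simp add: sum_divide_distrib)
qed

text \<open>
  For \<open>f\<close> the dipole potential of \<open>i\<close> normalised by \<open>f p = 0\<close>, pair \<open>f\<^sup>3\<close> with \<open>f\<close> and use
  \<open>4 (a\<^sup>3 - b\<^sup>3) (a - b) = 3 (a\<^sup>2 - b\<^sup>2)\<^sup>2 + (a - b)\<^sup>4\<close>.
\<close>

lemma energy_dipole_cube:
  assumes i: "i \<in> arcs G" and p: "p \<in> verts G"
  shows "3 * (\<Sum>e\<in>arcs G. (grad G (dipole_sq G g p i) e)\<^sup>2 / L e) + (\<Sum>e\<in>arcs G. (transfer G g e i) ^ 4 / L e)
    = transfer G g i i * (3 * (grad G (resistance g p) i)\<^sup>2 + (transfer G g i i)\<^sup>2)"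
proof -
  let ?f = "\<lambda>x. dipole G g i x - dipole G g i p"
  have id: "4 * ((a^3 - b^3) * (a - b)) = 3 * (a\<^sup>2 - b\<^sup>2)\<^sup>2 + (a - b) ^ 4" for a b :: real
    by (simp add: power4_eq_xxxx power3_eq_cube power2_eq_square algebra_simps)
  have "3 * (grad G (dipole_sq G g p i) e)\<^sup>2 + (transfer G g e i) ^ 4
      = 4 * (grad G (\<lambda>x. (?f x) ^ 3) e * transfer G g e i)" for e
    using id[of "?f (tail G e)" "?f (head G e)"]
    by (simp add: grad_def dipole_sq_def transfer_def)
  then have "3 * (\<Sum>e\<in>arcs G. (grad G (dipole_sq G g p i) e)\<^sup>2 / L e) + (\<Sum>e\<in>arcs G. (transfer G g e i) ^ 4 / L e)
      = 4 * (\<Sum>e\<in>arcs G. grad G (\<lambda>x. (?f x) ^ 3) e * transfer G g e i / L e)"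
    unfolding sum_distrib_left sum.distrib[symmetric]
    by (intro sum.cong refl) (simp flip: add_divide_distrib)
  also have "\<dots> = 4 * grad G (\<lambda>x. (?f x) ^ 3) i"
    unfolding energy_dipole[OF i] ..
  also have "\<dots> = transfer G g i i * (3 * (grad G (resistance g p) i)\<^sup>2 + (transfer G g i i)\<^sup>2)"
  proof -
    let ?a = "?f (tail G i)" and ?b = "?f (head G i)"
    have K: "transfer G g i i = ?a - ?b" by (simp add: transfer_def grad_def)
    have D: "grad G (resistance g p) i = ?a + ?b"
      using i p green_sym[of "tail G i" "head G i"]
        green_sym[of p "tail G i"] green_sym[of p "head G i"]
      by (simp add: grad_def dipole_def resistance_def)
    have "4 * (a^3 - b^3) = (a - b) * (3 * (a + b)\<^sup>2 + (a - b)\<^sup>2)" for a b :: real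
      by (simp add: power3_eq_cube power2_eq_square algebra_simps)
    then show ?thesis unfolding K D by (simp add: grad_def)
  qed
  finally show ?thesis .
qed

section \<open>Summing over all deletions\<close>

lemma deletion_weight:
  assumes i: "i \<in> arcs G" and nb: "\<not> bridge G i"
  shows "L i / (L i + R G L i) = (L i - transfer G g i i) / L i"
proof -
  have "L i > 0" "L i \<noteq> transfer G g i i"
    using i nb length_pos bridge_iff[OF i] by auto
  moreover from this have "L i + transfer G g i i * L i / (L i - transfer G g i i) =
      L i * L i / (L i - transfer G g i i)"
    by (simp add: field_simps)
  ultimately show ?thesis unfolding R_eq[OF i nb] by simp
qed

lemma sum_deletion_weight:
  "(\<Sum>i\<in>arcs G. (L i - transfer G g i i) / L i) = real_of_int (genus G)"
proof -
  have "(\<Sum>i\<in>arcs G. (L i - transfer G g i i) / L i) = (\<Sum>i\<in>arcs G. 1 - transfer G g i i / L i)"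
    using length_pos by (intro sum.cong refl) (force simp: diff_divide_distrib)
  then show ?thesis
    by (simp add: sum_subtractf foster genus_def)
qed

text \<open>The last term is the share of \<open>i\<close> itself: with \<open>c = L - K\<close>,
  its perturbed value \<open>K + K^2 / c = K L / c\<close> has weight \<open>c / L\<close>.\<close>

lemma deletion_transfer:
  assumes i: "i \<in> arcs G" and nb: "\<not> bridge G i"
  shows "(L i - transfer G g i i) / L i *
      (\<Sum>e\<in>arcs G - {i}. transfer (del_arc i) (green_del G L g i) e e) =
    (L i - transfer G g i i) / L i * (\<Sum>e\<in>arcs G. transfer G g e e)
      + (\<Sum>e\<in>arcs G. (transfer G g e i)\<^sup>2) / L i - transfer G g i i"
proof -
  let ?K = "transfer G g i i" let ?c = "L i - ?K"
  have nz: "L i \<noteq> 0" "?c \<noteq> 0" using i nb length_pos[OF i] bridge_iff[OF i] by auto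
  have "(\<Sum>e\<in>arcs G - {i}. transfer (del_arc i) (green_del G L g i) e e) =
      (\<Sum>e\<in>arcs G. transfer G g e e) + (\<Sum>e\<in>arcs G. (transfer G g e i)\<^sup>2) / ?c - (?K + ?K\<^sup>2 / ?c)"
    using i by (simp add: sum_diff1 transfer_green_del sum.distrib sum_divide_distrib)
  moreover have "?c / L i * (a + b / ?c - (?K + ?K\<^sup>2 / ?c)) = ?c / L i * a + b / L i - ?K" for a b
    using nz by (simp add: power2_eq_square divide_simps) (simp add: algebra_simps)
  ultimately show ?thesis by simp
qed

text \<open>Summed over \<open>i\<close>, the gain from the perturbation equals, by
  \<open>energy_transfer'\<close>, the loss of the deleted edges.\<close>

lemma sum_deletion_transfer:
  assumes "bridgeless G"
  shows "(\<Sum>i\<in>arcs G. (L i - transfer G g i i) / L i *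
      (\<Sum>e\<in>arcs G - {i}. transfer (del_arc i) (green_del G L g i) e e)) =
    real_of_int (genus G) * (\<Sum>e\<in>arcs G. transfer G g e e)"
proof -
  let ?w = "\<lambda>i. (L i - transfer G g i i) / L i"
  let ?s = "\<Sum>e\<in>arcs G. transfer G g e e"
  have swap: "(\<Sum>i\<in>arcs G. (\<Sum>e\<in>arcs G. (transfer G g e i)\<^sup>2) / L i) = ?s"
    unfolding sum_divide_distrib by (subst sum.swap) (simp add: energy_transfer')
  have nb: "\<not> bridge G i" if "i \<in> arcs G" for i
    using assms that by (simp add: bridgeless_def)
  have "(\<Sum>i\<in>arcs G. ?w i * (\<Sum>e\<in>arcs G - {i}. transfer (del_arc i) (green_del G L g i) e e)) =
      (\<Sum>i\<in>arcs G. ?w i * ?s + (\<Sum>e\<in>arcs G. (transfer G g e i)\<^sup>2) / L i - transfer G g i i)"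
    by (intro sum.cong refl deletion_transfer nb)
  also have "\<dots> = (\<Sum>i\<in>arcs G. ?w i) * ?s + ?s - ?s"
    unfolding sum.distrib sum_subtractf swap sum_distrib_right ..
  finally show ?thesis unfolding sum_deletion_weight by simp
qed

text \<open>\<open>energy_dipole_cube\<close> evaluates the terms of order \<open>1 / c\<^sup>2\<close>, where \<open>c = L i - transfer G g i i\<close>.\<close>

lemma deletion_energy:
  fixes p
  defines "D \<equiv> \<lambda>e. grad G (resistance g p) e"
  assumes i: "i \<in> arcs G" and nb: "\<not> bridge G i" and p: "p \<in> verts G"
  shows "(L i - transfer G g i i) / L i *
      (\<Sum>e\<in>arcs G - {i}. ((transfer (del_arc i) (green_del G L g i) e e)\<^sup>2
         + 3 * (grad (del_arc i) (resistance (green_del G L g i) p) e)\<^sup>2) / L e) =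
    (L i - transfer G g i i) / L i * (\<Sum>e\<in>arcs G. ((transfer G g e e)\<^sup>2 + 3 * (D e)\<^sup>2) / L e)
      + 2 * ((\<Sum>e\<in>arcs G. transfer G g e e * (transfer G g e i)\<^sup>2 / L e) / L i
           + 3 * ((\<Sum>e\<in>arcs G. D e * grad G (dipole_sq G g p i) e / L e) / L i))
      - ((transfer G g i i)\<^sup>2 + 3 * (D i)\<^sup>2) / L i"
proof -
  let ?K = "transfer G g i i" let ?c = "L i - ?K"
  let ?h = "\<lambda>e. grad G (dipole_sq G g p i) e"
  have nz: "L i \<noteq> 0" "?c \<noteq> 0" using i nb length_pos[OF i] bridge_iff[OF i] by auto
  \<comment> \<open>The perturbed summand is taken on all edges, \<open>i\<close> included, so that
    the energy identities of \<open>G\<close> apply; \<open>?X i\<close> is subtracted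
    afterwards.\<close>
  let ?X = "\<lambda>e. ((transfer G g e e + (transfer G g e i)\<^sup>2 / ?c)\<^sup>2 + 3 * (D e + ?h e / ?c)\<^sup>2) / L e"
  have exp: "((k + t\<^sup>2 / c)\<^sup>2 + 3 * (d + h / c)\<^sup>2) / l =
      (k\<^sup>2 + 3 * d\<^sup>2) / l + 2 / c * (k * t\<^sup>2 / l) + 6 / c * (d * h / l)
        + 1 / c\<^sup>2 * (3 * (h\<^sup>2 / l) + t ^ 4 / l)" for k t c d h l :: real
    by (simp add: power2_eq_square power4_eq_xxxx algebra_simps add_divide_distrib)
  have cube: "(\<Sum>e\<in>arcs G. 3 * ((?h e)\<^sup>2 / L e) + (transfer G g e i) ^ 4 / L e) =
      ?K * (3 * (D i)\<^sup>2 + ?K\<^sup>2)"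
    using energy_dipole_cube[OF i p] by (simp add: D_def sum.distrib sum_distrib_left)
  have all: "(\<Sum>e\<in>arcs G. ?X e) =
      (\<Sum>e\<in>arcs G. ((transfer G g e e)\<^sup>2 + 3 * (D e)\<^sup>2) / L e)
      + 2 / ?c * (\<Sum>e\<in>arcs G. transfer G g e e * (transfer G g e i)\<^sup>2 / L e)
      + 6 / ?c * (\<Sum>e\<in>arcs G. D e * ?h e / L e)
      + 1 / ?c\<^sup>2 * (?K * (3 * (D i)\<^sup>2 + ?K\<^sup>2))"
    unfolding exp cube[symmetric] sum_distrib_left sum.distrib[symmetric] ..
  have "(\<Sum>e\<in>arcs G - {i}. ((transfer (del_arc i) (green_del G L g i) e e)\<^sup>2
         + 3 * (grad (del_arc i) (resistance (green_del G L g i) p) e)\<^sup>2) / L e) = (\<Sum>e\<in>arcs G. ?X e) - ?X i"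
    using i by (simp add: sum_diff1 transfer_green_del grad_resistance_green_del D_def)
  moreover have "?h i = ?K * D i"
    using grad_dipole_sq_self[OF i p] by (simp add: D_def)
  moreover have "c / l * (y + 2 / c * s + 6 / c * t + 1 / c\<^sup>2 * (k * (3 * d\<^sup>2 + k\<^sup>2))
        - ((k + k\<^sup>2 / c)\<^sup>2 + 3 * (d + k * d / c)\<^sup>2) / l) =
      c / l * y + 2 * (s / l + 3 * (t / l)) - (k\<^sup>2 + 3 * d\<^sup>2) / l"
    if "l \<noteq> 0" "c \<noteq> 0" "c = l - k" for c l k d s t y :: real
  proof -
    have k: "k + k\<^sup>2 / c = l * k / c" "d + k * d / c = l * d / c"
      using that(1,2) unfolding that(3) by (simp_all add: field_simps power2_eq_square)
    have "c / l * (y + 2 / c * s + 6 / c * t + 1 / c\<^sup>2 * (k * (3 * d\<^sup>2 + k\<^sup>2))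
        - ((l * k / c)\<^sup>2 + 3 * (l * d / c)\<^sup>2) / l) =
       c / l * y + 2 * (s / l + 3 * (t / l)) + (k / (c * l) - 1 / c) * (k\<^sup>2 + 3 * d\<^sup>2)"
      using that(1,2) by (simp add: divide_simps power2_eq_square) (simp add: algebra_simps)
    \<comment> \<open>The first fraction comes from \<open>cube\<close>, the second from removing
      the term of \<open>i\<close>; the pole in \<open>c\<close> cancels.\<close>
    moreover have "k / (c * l) - 1 / c = - 1 / l"
    proof -
      have "k = l - c" using that(3) by simp
      show ?thesis using that(1,2) unfolding \<open>k = l - c\<close> by (simp add: field_simps)
    qed
    ultimately show ?thesis unfolding k by simp
  qed
  ultimately show ?thesis unfolding all using nz by simp
qed

text \<open>The weights contribute the genus times \<open>?Y\<close>, the first-order terms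
  \<open>2 * ?Y\<close>, and the deleted edges \<open>- ?Y\<close>.\<close>

lemma sum_deletion_energy:
  assumes "bridgeless G" and p: "p \<in> verts G"
  shows "(\<Sum>i\<in>arcs G. (L i - transfer G g i i) / L i *
      (\<Sum>e\<in>arcs G - {i}. ((transfer (del_arc i) (green_del G L g i) e e)\<^sup>2
         + 3 * (grad (del_arc i) (resistance (green_del G L g i) p) e)\<^sup>2) / L e)) =
    (real_of_int (genus G) + 1) *
      (\<Sum>e\<in>arcs G. ((transfer G g e e)\<^sup>2 + 3 * (grad G (resistance g p) e)\<^sup>2) / L e)"
    (is "_ = _ * ?Y")
proof -
  let ?D = "\<lambda>e. grad G (resistance g p) e"
  let ?S = "\<lambda>i. (\<Sum>e\<in>arcs G. transfer G g e e * (transfer G g e i)\<^sup>2 / L e) / L i"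
  let ?T = "\<lambda>i. (\<Sum>e\<in>arcs G. ?D e * grad G (dipole_sq G g p i) e / L e) / L i"
  have nb: "\<not> bridge G i" if "i \<in> arcs G" for i
    using assms that by (simp add: bridgeless_def)
  have lin: "(\<Sum>i\<in>arcs G. a i * y + 2 * b i - c i) =
      (\<Sum>i\<in>arcs G. a i) * y + 2 * (\<Sum>i\<in>arcs G. b i) - (\<Sum>i\<in>arcs G. c i)"
    for a b c :: "'b \<Rightarrow> real" and y :: real
    by (simp add: sum.distrib sum_subtractf sum_distrib_left sum_distrib_right)
  have "(\<Sum>i\<in>arcs G. ?S i) =
      (\<Sum>e\<in>arcs G. transfer G g e e / L e * (\<Sum>i\<in>arcs G. (transfer G g e i)\<^sup>2 / L i))"
    unfolding sum_divide_distrib sum_distrib_left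
    by (subst sum.swap) (simp add: mult.commute)
  also have "\<dots> = (\<Sum>e\<in>arcs G. (transfer G g e e)\<^sup>2 / L e)"
    by (intro sum.cong refl, simp only: energy_transfer') (simp add: power2_eq_square)
  finally have S: "(\<Sum>i\<in>arcs G. ?S i) = (\<Sum>e\<in>arcs G. (transfer G g e e)\<^sup>2 / L e)" .
  have ST: "(\<Sum>i\<in>arcs G. ?S i + 3 * ?T i) = ?Y"
    unfolding sum.distrib S sum_distrib_left[symmetric] sum_energy_resistance_dipole_sq[OF p]
    by (simp add: add_divide_distrib sum.distrib sum_distrib_left)
  have "(\<Sum>i\<in>arcs G. (L i - transfer G g i i) / L i *
      (\<Sum>e\<in>arcs G - {i}. ((transfer (del_arc i) (green_del G L g i) e e)\<^sup>2
         + 3 * (grad (del_arc i) (resistance (green_del G L g i) p) e)\<^sup>2) / L e)) =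
     (\<Sum>i\<in>arcs G. (L i - transfer G g i i) / L i * ?Y + 2 * (?S i + 3 * ?T i)
        - ((transfer G g i i)\<^sup>2 + 3 * (?D i)\<^sup>2) / L i)"
    by (intro sum.cong refl deletion_energy nb p)
  also have "\<dots> = (\<Sum>i\<in>arcs G. (L i - transfer G g i i) / L i) * ?Y + 2 * (\<Sum>i\<in>arcs G. ?S i + 3 * ?T i) - ?Y"
    by (rule lin)
  finally show ?thesis unfolding ST sum_deletion_weight by (simp add: algebra_simps)
qed

end

end

theorem theorem4p17:
  fixes \<Gamma> :: "('a, 'b) pre_digraph" and L :: "'b \<Rightarrow> real"
    and p :: 'a and q :: "'b \<Rightarrow> 'a"
  assumes "metrized_graph \<Gamma> L"
    and "bridgeless \<Gamma>"
    and "p \<in> verts \<Gamma>"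
    and "\<And>i. i \<in> arcs \<Gamma> \<Longrightarrow> q i \<in> verts (pre_digraph.del_arc \<Gamma> i)"
  shows "real_of_int (genus \<Gamma>) * x_inv \<Gamma> L p =
           y_inv \<Gamma> L p +
           (\<Sum>i \<in> arcs \<Gamma>. L i / (L i + R \<Gamma> L i) * x_inv (pre_digraph.del_arc \<Gamma> i) L (q i))
       \<and> (real_of_int (genus \<Gamma>) + 1) * y_inv \<Gamma> L p =
           (\<Sum>i \<in> arcs \<Gamma>. L i / (L i + R \<Gamma> L i) * y_inv (pre_digraph.del_arc \<Gamma> i) L (q i))"
proof -
  interpret metrized_graph \<Gamma> L by fact
  obtain g where green: "is_green \<Gamma> L g" by (rule ex_green)
  \<comment> \<open>Below, \<open>s i\<close> is \<open>x + y\<close> and \<open>y i\<close> is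
    \<open>4 y\<close> of the deletion, with \<open>p\<close> as common base point.\<close>
  define w where "w i = (L i - transfer \<Gamma> g i i) / L i" for i
  define s where "s i = (\<Sum>e\<in>arcs \<Gamma> - {i}. transfer (del_arc i) (green_del \<Gamma> L g i) e e)" for i
  define y where "y i = (\<Sum>e\<in>arcs \<Gamma> - {i}. ((transfer (del_arc i) (green_del \<Gamma> L g i) e e)\<^sup>2
         + 3 * (grad (del_arc i) (resistance (green_del \<Gamma> L g i) p) e)\<^sup>2) / L e)" for i
  note p = assms(3)
  have weight: "L i / (L i + R \<Gamma> L i) = w i" and y_del: "y_inv (del_arc i) L (q i) = y i / 4"
    and x_del: "x_inv (del_arc i) L (q i) = s i - y i / 4" if i: "i \<in> arcs \<Gamma>" for i
  proof -
    have nb: "\<not> bridge \<Gamma> i" using assms(2) i by (simp add: bridgeless_def)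
    show "L i / (L i + R \<Gamma> L i) = w i"
      unfolding w_def by (rule deletion_weight[OF green i nb])
    interpret D: metrized_graph "del_arc i" L by (rule metrized_graph_del_arc[OF i nb])
    note gr = is_green_green_del[OF green i nb]
    have pq: "q i \<in> verts (del_arc i)" "p \<in> verts (del_arc i)"
      using assms(4)[OF i] p by simp_all
    show y: "y_inv (del_arc i) L (q i) = y i / 4"
      unfolding D.y_inv_base_indep[OF gr pq] D.y_inv_eq[OF gr pq(2)] y_def by simp
    show "x_inv (del_arc i) L (q i) = s i - y i / 4"
      unfolding D.x_inv_eq[OF gr pq(1)] y s_def by simp
  qed
  have "(\<Sum>i\<in>arcs \<Gamma>. w i * y i) = (real_of_int (genus \<Gamma>) + 1) * (4 * y_inv \<Gamma> L p)"
    using sum_deletion_energy[OF green assms(2) p] y_inv_eq[OF green p] unfolding w_def y_def by simp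
  then have ys: "(\<Sum>i\<in>arcs \<Gamma>. w i * (y i / 4)) = (real_of_int (genus \<Gamma>) + 1) * y_inv \<Gamma> L p"
    by (simp flip: sum_divide_distrib)
  have "(\<Sum>i\<in>arcs \<Gamma>. w i * s i) = real_of_int (genus \<Gamma>) * (\<Sum>e\<in>arcs \<Gamma>. transfer \<Gamma> g e e)"
    unfolding w_def s_def by (rule sum_deletion_transfer[OF green assms(2)])
  \<comment> \<open>Since the sum of \<open>transfer \<Gamma> g e e\<close> is \<open>x + y\<close>,
    the right side is the genus times \<open>x\<close>, minus \<open>y\<close>.\<close>
  then have "(\<Sum>i\<in>arcs \<Gamma>. w i * (s i - y i / 4)) =
      real_of_int (genus \<Gamma>) * (\<Sum>e\<in>arcs \<Gamma>. transfer \<Gamma> g e e) - (real_of_int (genus \<Gamma>) + 1) * y_inv \<Gamma> L p"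
    unfolding right_diff_distrib sum_subtractf ys by simp
  then show ?thesis
    using ys by (simp add: weight y_del x_del x_inv_eq[OF green p] algebra_simps)
qed

end
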